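(* Let $n\ge 2$, let $x_1,\dots,x_n,y$ be propositional variables and let $p_1,\dots,p_{n-1}$ be fresh propositional variables. The CNF formula $$(\neg x_1\vee p_1)\wedge(\neg y\vee\neg x_n\vee\neg p_{n-1})\wedge\bigwedge_{1<i<n}\Big[(\neg x_i\vee p_i)\wedge(\neg p_{i-1}\vee p_i)\wedge(\neg y\vee\neg x_i\vee\neg p_{i-1})\Big],$$ which encodes the conditional constraint $y\rightarrow\sum_{i=1}^n x_i\le 1$ (via the sequential counter or pigeon-hole encoding), maintains generalized arc consistency by unit propagation.
   Context: Unit propagation on a CNF formula repeatedly picks a unit clause $\{l\}$, deletes all clauses containing $l$ and removes the complement of $l$ from the other clauses; a literal is derived by unit propagation if it occurs as a unit clause at some stage, and a conflict is derived if the empty clause appears. For a set of literals $\rho$, unit propagation on $\mathcal F$ under $\rho$ means unit propagation on $\mathcal F\wedge\bigwedge_{l\in\rho}l$. A partial assignment of $x_1,\dots,x_n$ is a set of literals over these variables containing no complementary pair. A CNF formula $\mathcal F$ over $y,x_1,\dots,x_n$ and auxiliary variables maintains generalized arc consistency (GAC) by unit propagation for $y\rightarrow\sum_{i=1}^n x_i\le k$ if for every partial assignment $\rho$ of $x_1,\dots,x_n$: (i) (when $y$ is true, GAC is maintained on the cardinality constraint) under $\rho\cup\{y\}$: if more than $k$ of the $x_i$ are true in $\rho$, unit propagation on $\mathcal F$ derives a conflict; and if exactly $k$ of the $x_i$ are true in $\rho$, unit propagation derives $\neg x_j$ for every $x_j$ not assigned by $\rho$; (ii) if more than $k$ of the $x_i$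 are true in $\rho$ (the cardinality constraint is false), unit propagation on $\mathcal F$ under $\rho$ derives $\neg y$. Here $k=1$. *)

theory Defs
  imports Main
begin

datatype 'v literal = Pos 'v | Neg 'v

fun complement :: "'v literal \<Rightarrow> 'v literal" where
  "complement (Pos v) = Neg v"
| "complement (Neg v) = Pos v"

type_synonym 'v clause = "'v literal set"
type_synonym 'v cnf = "'v clause set"

fun lit_true :: "('v \<Rightarrow> bool) \<Rightarrow> 'v literal \<Rightarrow> bool" where
  "lit_true \<alpha> (Pos v) = \<alpha> v"
| "lit_true \<alpha> (Neg v) = (\<not> \<alpha> v)"

definition satisfies :: "('v \<Rightarrow> bool) \<Rightarrow> 'v cnf \<Rightarrow> bool" where
  "satisfies \<alpha> F \<longleftrightarrow> (\<forall>C\<in>F. \<exists>l\<in>C. lit_true \<alpha> l)"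

definition propagate :: "'v literal \<Rightarrow> 'v cnf \<Rightarrow> 'v cnf" where
  "propagate l F = {C - {complement l} | C. C \<in> F \<and> l \<notin> C}"

text \<open>A run is the sequence of all stages of one execution, with arbitrary choices of the
  unit clauses; it becomes stationary when no unit clause is left.\<close>

definition up_run :: "'v cnf \<Rightarrow> (nat \<Rightarrow> 'v cnf) \<Rightarrow> bool" where
  "up_run F S \<longleftrightarrow> S 0 = F \<and>
     (\<forall>t. if \<exists>l. {l} \<in> S t
          then \<exists>l. {l} \<in> S t \<and> S (Suc t) = propagate l (S t)
          else S (Suc t) = S t)"

text \<open>Derivability is required for every order in which unit clauses are picked.  On finite
  formulas the order is irrelevant for deriving a conflict, and it is irrelevant for deriving
  a literal unless a conflict is derived as well.\<close>

definition up_derives :: "'v cnf \<Rightarrow> 'v literal \<Rightarrow> bool" where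
  "up_derives F l \<longleftrightarrow> (\<forall>S. up_run F S \<longrightarrow> (\<exists>t. {l} \<in> S t))"

definition up_conflict :: "'v cnf \<Rightarrow> bool" where
  "up_conflict F \<longleftrightarrow> (\<forall>S. up_run F S \<longrightarrow> (\<exists>t. {} \<in> S t))"

definition under :: "'v cnf \<Rightarrow> 'v literal set \<Rightarrow> 'v cnf" where
  "under F \<rho> = F \<union> {{l} | l. l \<in> \<rho>}"

definition partial_assignment :: "'v set \<Rightarrow> 'v literal set \<Rightarrow> bool" where
  "partial_assignment V \<rho> \<longleftrightarrow>
     \<rho> \<subseteq> Pos ` V \<union> Neg ` V \<and> \<not> (\<exists>l\<in>\<rho>. complement l \<in> \<rho>)"

definition num_true :: "nat \<Rightarrow> (nat \<Rightarrow> 'v) \<Rightarrow> 'v literal set \<Rightarrow> nat" where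
  "num_true n x \<rho> = card {i \<in> {1..n}. Pos (x i) \<in> \<rho>}"

definition encodes_cond_at_most ::
    "'v cnf \<Rightarrow> nat \<Rightarrow> (nat \<Rightarrow> 'v) \<Rightarrow> 'v \<Rightarrow> nat \<Rightarrow> bool" where
  "encodes_cond_at_most F n x y k \<longleftrightarrow>
     (\<forall>\<alpha>. (\<alpha> y \<longrightarrow> (\<Sum>i=1..n. of_bool (\<alpha> (x i))) \<le> k) \<longleftrightarrow>
          (\<exists>\<beta>. (\<forall>v \<in> insert y (x ` {1..n}). \<beta> v = \<alpha> v) \<and> satisfies \<beta> F))"

definition up_maintains_gac ::
    "'v cnf \<Rightarrow> nat \<Rightarrow> (nat \<Rightarrow> 'v) \<Rightarrow> 'v \<Rightarrow> nat \<Rightarrow> bool" where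
  "up_maintains_gac F n x y k \<longleftrightarrow>
     (\<forall>\<rho>. partial_assignment (x ` {1..n}) \<rho> \<longrightarrow>
        (num_true n x \<rho> > k \<longrightarrow> up_conflict (under F (\<rho> \<union> {Pos y}))) \<and>
        (num_true n x \<rho> = k \<longrightarrow>
           (\<forall>j\<in>{1..n}. Pos (x j) \<notin> \<rho> \<and> Neg (x j) \<notin> \<rho> \<longrightarrow>
              up_derives (under F (\<rho> \<union> {Pos y})) (Neg (x j)))) \<and>
        (num_true n x \<rho> > k \<longrightarrow> up_derives (under F \<rho>) (Neg y)))"

definition cond_amo_cnf :: "nat \<Rightarrow> (nat \<Rightarrow> 'v) \<Rightarrow> 'v \<Rightarrow> (nat \<Rightarrow> 'v) \<Rightarrow> 'v cnf" where
  "cond_amo_cnf n x y p =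
     {{Neg (x 1), Pos (p 1)}, {Neg y, Neg (x n), Neg (p (n - 1))}} \<union>
     (\<Union>i\<in>{1<..<n}.
        {{Neg (x i), Pos (p i)},
         {Neg (p (i - 1)), Pos (p i)},
         {Neg y, Neg (x i), Neg (p (i - 1))}})"

end

(* Every run of unit propagation on a formula with finitely many literals stops, and unless it
   derives a conflict, the picked literals form a consistent set closed under the unit
   propagation rule.  So a conflict is derived if no consistent closed set exists, and a
   satisfiable formula derives every literal common to all consistent closed sets.  Satisfiability
   matters because a run through a conflict may lose literals.

   For the sequential counter, x_i forces p_i, ..., p_(n-1), hence (with y) the negations of all
   later x_j; and x_j together with y forces the negations of p_(j-1), ..., p_1 and thus of all
   earlier x_i.  Two true inputs x_i and x_j with i < j force the negation of y through p_(j-1). *)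

theory Submission
  imports Defs
begin

section \<open>Closed sets of literals\<close>

lemma complement_complement [simp]: "complement (complement l) = l"
  by (cases l) auto

lemma complement_neq [simp]: "complement l \<noteq> l"
  by (cases l) auto

lemma lit_true_complement [simp]: "lit_true \<alpha> (complement l) \<longleftrightarrow> \<not> lit_true \<alpha> l"
  by (cases l) auto

lemma in_complement_image_iff: "l \<in> complement ` P \<longleftrightarrow> complement l \<in> P"
  by (metis complement_complement imageE imageI)

definition consistent :: "'v literal set \<Rightarrow> bool" where
  "consistent P \<longleftrightarrow> (\<forall>l\<in>P. complement l \<notin> P)"

text \<open>A nonempty clause falsified by \<open>P\<close> forces its own literals into
  \<open>P\<close>, so a conflict in such a clause shows up as a violation of
  \<open>consistent P\<close>.\<close>

definition up_closed :: "'v cnf \<Rightarrow> 'v literal set \<Rightarrow> bool" where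
  "up_closed F P \<longleftrightarrow> (\<forall>C\<in>F. \<forall>l\<in>C. (\<forall>m\<in>C. m \<noteq> l \<longrightarrow> complement m \<in> P) \<longrightarrow> l \<in> P)"

lemma up_closedD:
  assumes "up_closed F P" "C \<in> F" "l \<in> C" "\<And>m. m \<in> C \<Longrightarrow> m \<noteq> l \<Longrightarrow> complement m \<in> P"
  shows "l \<in> P"
  using assms unfolding up_closed_def by blast

text \<open>If every other literal of a clause is false, the literal that satisfies it must be the
  remaining one. This lets facts about closed sets be reused for models.\<close>

lemma up_closed_model:
  assumes "satisfies \<alpha> F"
  shows "up_closed F {l. lit_true \<alpha> l}"
  using assms unfolding up_closed_def satisfies_def by fastforce

lemma up_closed_under: "up_closed (under F \<rho>) P \<Longrightarrow> up_closed F P \<and> \<rho> \<subseteq> P"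
  unfolding up_closed_def under_def by auto

lemma satisfies_under:
  "satisfies \<alpha> (under F \<rho>) \<longleftrightarrow> satisfies \<alpha> F \<and> (\<forall>l\<in>\<rho>. lit_true \<alpha> l)"
  unfolding satisfies_def under_def by blast

section \<open>Runs of unit propagation\<close>

text \<open>Closed form of the stage reached once the literals in \<open>P\<close> have been picked;
  it does not depend on the order of the picks.\<close>

definition residual :: "'v cnf \<Rightarrow> 'v literal set \<Rightarrow> 'v cnf" where
  "residual F P = {C - complement ` P | C. C \<in> F \<and> C \<inter> P = {}}"

text \<open>As \<open>complement l\<close> is not in \<open>P\<close>, deleting the literals
  falsified by \<open>P\<close> never deletes \<open>l\<close>, so a residual clause contains
  \<open>l\<close> exactly when its original does.\<close>

lemma propagate_residual:
  assumes "complement l \<notin> P"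
  shows "propagate l (residual F P) = residual F (insert l P)"
proof -
  have "l \<notin> complement ` P"
    using assms by (simp add: in_complement_image_iff)
  then have "C \<inter> P = {} \<and> l \<notin> C - complement ` P \<longleftrightarrow> C \<inter> insert l P = {}" for C
    by blast
  moreover have "C - complement ` P - {complement l} = C - complement ` insert l P" for C
    by blast
  moreover have "propagate l (residual F P) = {C - complement ` P - {complement l} | C.
      C \<in> F \<and> C \<inter> P = {} \<and> l \<notin> C - complement ` P}"
    unfolding propagate_def residual_def by blast
  ultimately show ?thesis
    unfolding residual_def by simp
qed

text \<open>Surviving clauses avoid \<open>P\<close> and have lost the complements of
  \<open>P\<close>. Hence every pick is new, which bounds the run, and keeps the picked set
  consistent.\<close>

lemma unit_in_residual:
  assumes "{l} \<in> residual F P"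
  shows "l \<notin> P" "complement l \<notin> P" "l \<in> \<Union> F"
proof -
  obtain C where C: "C \<in> F" "C \<inter> P = {}" "{l} = C - complement ` P"
    using assms unfolding residual_def by blast
  then show "l \<notin> P" "l \<in> \<Union> F" by blast+
  show "complement l \<notin> P"
    using C(3) by (metis Diff_iff in_complement_image_iff singletonI)
qed

text \<open>Suppose \<open>P\<close> falsifies all of a clause except \<open>l\<close>, and
  \<open>l\<close> is not in \<open>P\<close>. By consistency the clause is not satisfied by
  \<open>P\<close>, so it survives as \<open>{l}\<close> or as the empty clause, and both are
  excluded.\<close>

lemma residual_up_closed:
  assumes "consistent P" "\<nexists>l. {l} \<in> residual F P" "{} \<notin> residual F P"
  shows "up_closed F P"
  unfolding up_closed_def
proof (intro ballI impI, rule ccontr)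
  fix C l
  assume *: "C \<in> F" "l \<in> C" "\<forall>m\<in>C. m \<noteq> l \<longrightarrow> complement m \<in> P" "l \<notin> P"
  have "C \<inter> P = {}"
    using *(3,4) assms(1) unfolding consistent_def by (metis disjoint_iff)
  then have "C - complement ` P \<in> residual F P"
    using *(1) unfolding residual_def by blast
  moreover have "C - complement ` P \<subseteq> {l}"
    using *(3) by (auto simp: in_complement_image_iff)
  ultimately show False
    using assms(2,3) by (metis subset_singletonD)
qed

text \<open>The run invariant. Its last disjunct is the termination measure: each step either
  enlarges \<open>P\<close> by a new literal or finds the run already stationary.\<close>

lemma up_run_residual:
  assumes "up_run F S" and fin: "finite (\<Union> F)"
  shows "\<exists>P. S t = residual F P \<and> consistent P \<and> P \<subseteq> \<Union> F \<and> (\<forall>l\<in>P. \<exists>s. {l} \<in> S s) \<and>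
    (t \<le> card P \<or> (\<nexists>l. {l} \<in> S t))"
proof (induction t)
  case 0
  have "S 0 = residual F {}"
    using assms(1) by (simp add: up_run_def residual_def)
  then show ?case
    by (intro exI[of _ "{}"]) (simp add: consistent_def)
next
  case (Suc t)
  then obtain P where P: "S t = residual F P" "consistent P" "P \<subseteq> \<Union> F"
    "\<forall>l\<in>P. \<exists>s. {l} \<in> S s" "t \<le> card P \<or> (\<nexists>l. {l} \<in> S t)"
    by blast
  have step: "if \<exists>l. {l} \<in> S t then \<exists>l. {l} \<in> S t \<and> S (Suc t) = propagate l (S t)
      else S (Suc t) = S t"
    using assms(1) unfolding up_run_def by blast
  show ?case
  proof (cases "\<exists>l. {l} \<in> S t")
    case True
    then obtain l where l: "{l} \<in> S t" "S (Suc t) = propagate l (S t)"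
      using step by auto
    note u = unit_in_residual[OF l(1)[unfolded P(1)]]
    have "finite P"
      using P(3) fin by (rule finite_subset)
    then have "Suc t \<le> card (insert l P)"
      using P(5) True u(1) by simp
    moreover have "S (Suc t) = residual F (insert l P)"
      using l(2) P(1) propagate_residual[OF u(2)] by simp
    moreover have "consistent (insert l P)"
      using P(2) u(2) unfolding consistent_def
      by (metis complement_complement complement_neq insert_iff)
    ultimately show ?thesis
      using P(3,4) u(3) l(1) by (intro exI[of _ "insert l P"]) blast
  next
    case False
    then show ?thesis
      using step P by auto
  qed
qed

lemma up_run_closed:
  assumes "up_run F S" "finite (\<Union> F)"
  obtains t where "{} \<in> S t"
  | P where "consistent P" "up_closed F P" "\<And>l. l \<in> P \<Longrightarrow> \<exists>t. {l} \<in> S t"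
proof -
  \<comment> \<open>One more than the number of available literals, so \<open>t \<le> card P\<close>
    is impossible and stage \<open>t\<close> has no unit clause.\<close>
  define t where "t = Suc (card (\<Union> F))"
  obtain P where P: "S t = residual F P" "consistent P" "P \<subseteq> \<Union> F"
    "\<forall>l\<in>P. \<exists>s. {l} \<in> S s" "t \<le> card P \<or> (\<nexists>l. {l} \<in> S t)"
    using up_run_residual[OF assms, of t] by blast
  have "card P < t"
    using card_mono[OF assms(2) P(3)] by (simp add: t_def)
  then have "\<nexists>l. {l} \<in> residual F P"
    using P(1,5) by auto
  then show thesis
    using residual_up_closed[OF P(2)] P that by metis
qed

text \<open>A model makes the picked unit literal true, so propagation strips only false literals
  from clauses. It follows that a satisfiable formula never reaches the empty clause.\<close>

lemma satisfies_up_run: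
  assumes "up_run F S" "satisfies \<alpha> F"
  shows "satisfies \<alpha> (S t)"
proof (induction t)
  case 0
  then show ?case using assms by (simp add: up_run_def)
next
  case (Suc t)
  consider "S (Suc t) = S t" | l where "{l} \<in> S t" "S (Suc t) = propagate l (S t)"
    using assms(1) unfolding up_run_def by metis
  then show ?case
  proof cases
    case 1
    then show ?thesis using Suc by simp
  next
    case 2
    then have "lit_true \<alpha> l"
      using Suc unfolding satisfies_def by fastforce
    then have "\<not> lit_true \<alpha> (complement l)"
      by simp
    then show ?thesis
      using Suc 2(2) unfolding satisfies_def propagate_def by fastforce
  qed
qed

lemma up_conflictI:
  assumes "finite (\<Union> F)" "\<And>P. consistent P \<Longrightarrow> up_closed F P \<Longrightarrow> False"
  shows "up_conflict F"
  unfolding up_conflict_def using up_run_closed[OF _ assms(1)] assms(2) by metis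

text \<open>The model excludes the conflict case of \<open>up_run_closed\<close>; in the other case
  \<open>l\<close> lies in the set of picked literals, so it was a unit clause at some
  stage.\<close>

lemma up_derivesI:
  assumes "finite (\<Union> F)" "satisfies \<alpha> F"
    and "\<And>P. consistent P \<Longrightarrow> up_closed F P \<Longrightarrow> l \<in> P"
  shows "up_derives F l"
  unfolding up_derives_def
proof (intro allI impI)
  fix S
  assume S: "up_run F S"
  have "{} \<notin> S t" for t
    using satisfies_up_run[OF S assms(2), of t] unfolding satisfies_def by blast
  then show "\<exists>t. {l} \<in> S t"
    using up_run_closed[OF S assms(1)] assms(3) by metis
qed

section \<open>The sequential counter\<close>

text \<open>The two boundary clauses are the cases \<open>i = 1\<close> and \<open>i = n\<close> of
  the families inside the union, so absorbing them leaves three uniform families.\<close>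

lemma cond_amo_cnf_alt:
  assumes "n \<ge> 2"
  shows "cond_amo_cnf n x y p =
    (\<lambda>i. {Neg (x i), Pos (p i)}) ` {1..<n} \<union>
    (\<lambda>i. {Neg (p (i - 1)), Pos (p i)}) ` {1<..<n} \<union>
    (\<lambda>i. {Neg y, Neg (x i), Neg (p (i - 1))}) ` {1<..n}"
proof -
  have "{1..<n} = insert 1 {1<..<n}" "{1<..n} = insert n {1<..<n}"
    using assms by auto
  then have "{a 1, c n} \<union> (\<Union>i\<in>{1<..<n}. {a i, b i, c i}) =
      a ` {1..<n} \<union> b ` {1<..<n} \<union> c ` {1<..n}" for a b c :: "nat \<Rightarrow> 'a clause"
    by auto
  from this[of "\<lambda>i. {Neg (x i), Pos (p i)}" "\<lambda>i. {Neg y, Neg (x i), Neg (p (i - 1))}"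
      "\<lambda>i. {Neg (p (i - 1)), Pos (p i)}"]
  show ?thesis
    unfolding cond_amo_cnf_def .
qed

lemma finite_cond_amo_cnf:
  assumes "finite \<rho>"
  shows "finite (\<Union> (under (cond_amo_cnf n x y p) \<rho>))"
proof -
  have "finite (\<Union> (cond_amo_cnf n x y p))"
    unfolding cond_amo_cnf_def by (rule finite_Union) auto
  moreover have "\<Union> {{l} | l. l \<in> \<rho>} = \<rho>"
    by blast
  ultimately show ?thesis
    using assms by (simp add: under_def)
qed

text \<open>Instantiated both with closed sets arising from unit propagation and with the set of
  literals true in a model.\<close>

locale closed_counter =
  fixes n :: nat and x p :: "nat \<Rightarrow> 'v" and y :: 'v and P :: "'v literal set"
  assumes n: "n \<ge> 2" and closed: "up_closed (cond_amo_cnf n x y p) P"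
begin

lemma clauses:
  "i \<in> {1..<n} \<Longrightarrow> {Neg (x i), Pos (p i)} \<in> cond_amo_cnf n x y p"
  "i \<in> {1<..<n} \<Longrightarrow> {Neg (p (i - 1)), Pos (p i)} \<in> cond_amo_cnf n x y p"
  "i \<in> {1<..n} \<Longrightarrow> {Neg y, Neg (x i), Neg (p (i - 1))} \<in> cond_amo_cnf n x y p"
  unfolding cond_amo_cnf_alt[OF n] by blast+

lemma propagate_input:
  assumes "i \<in> {1..<n}"
  shows "Pos (x i) \<in> P \<Longrightarrow> Pos (p i) \<in> P" "Neg (p i) \<in> P \<Longrightarrow> Neg (x i) \<in> P"
  by (rule up_closedD[OF closed clauses(1)[OF assms]]; auto)+

lemma propagate_counter:
  assumes "Suc i \<in> {1<..<n}"
  shows "Pos (p i) \<in> P \<Longrightarrow> Pos (p (Suc i)) \<in> P" "Neg (p (Suc i)) \<in> P \<Longrightarrow> Neg (p i) \<in> P"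
  by (rule up_closedD[OF closed clauses(2)[OF assms]]; auto)+

lemma propagate_bound:
  assumes "i \<in> {1<..n}"
  shows "Pos (x i) \<in> P \<Longrightarrow> Pos (p (i - 1)) \<in> P \<Longrightarrow> Neg y \<in> P"
    "Pos y \<in> P \<Longrightarrow> Pos (p (i - 1)) \<in> P \<Longrightarrow> Neg (x i) \<in> P"
    "Pos y \<in> P \<Longrightarrow> Pos (x i) \<in> P \<Longrightarrow> Neg (p (i - 1)) \<in> P"
  by (rule up_closedD[OF closed clauses(3)[OF assms]]; auto)+

lemma counter_true:
  assumes "Pos (x i) \<in> P" "1 \<le> i" "i \<le> j" "j < n"
  shows "Pos (p j) \<in> P"
  using assms(3,4)
proof (induction j rule: dec_induct)
  case base
  then show ?case
    using assms(1,2) by (simp add: propagate_input)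
next
  case (step j)
  then show ?case
    using assms(2) by (simp add: propagate_counter)
qed

text \<open>The chain of \<open>counter_true\<close> read contrapositively: falsity of a counter
  variable travels down to smaller indices.\<close>

lemma counter_false:
  assumes "Neg (p j) \<in> P" "1 \<le> i" "i \<le> j" "j < n"
  shows "Neg (p i) \<in> P"
  using assms(3,2)
proof (induction i rule: inc_induct)
  case base
  show ?case by (rule assms(1))
next
  case (step i)
  then show ?case
    using assms(4) by (simp add: propagate_counter)
qed

lemma two_true:
  assumes "Pos (x i) \<in> P" "Pos (x j) \<in> P" "1 \<le> i" "i < j" "j \<le> n"
  shows "Neg y \<in> P"
proof -
  \<comment> \<open>\<open>p (j - 1)\<close> is the counter variable that shares a clause with
    \<open>x j\<close>, and \<open>i \<le> j - 1\<close>.\<close>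
  have "Pos (p (j - 1)) \<in> P"
    using assms by (intro counter_true[of i]) auto
  then show ?thesis
    using assms by (intro propagate_bound(1)[of j]) auto
qed

lemma one_true:
  assumes "Pos y \<in> P" "Pos (x i) \<in> P" "i \<in> {1..n}" "j \<in> {1..n}" "i \<noteq> j"
  shows "Neg (x j) \<in> P"
proof (cases "i < j")
  case True
  then have "Pos (p (j - 1)) \<in> P"
    using assms by (intro counter_true[of i]) auto
  then show ?thesis
    using assms True by (intro propagate_bound(2)) auto
next
  case False
  \<comment> \<open>Here \<open>j < i\<close>, so \<open>i\<close> is at least 2 and has a bound
    clause; from \<open>p (i - 1)\<close> the downward chain reaches \<open>p j\<close>.\<close>
  have "Neg (p (i - 1)) \<in> P"
    using assms False by (intro propagate_bound(3)) auto
  then have "Neg (p j) \<in> P"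
    by (rule counter_false) (use assms False in auto)
  then show ?thesis
    using assms False by (intro propagate_input(2)) auto
qed

end

section \<open>Models of the counter formula and correctness of the encoding\<close>

lemma card_gt_1_interval_iff:
  "card {i \<in> {1..n::nat}. Q i} > 1 \<longleftrightarrow> (\<exists>i j. 1 \<le> i \<and> i < j \<and> j \<le> n \<and> Q i \<and> Q j)"
proof -
  let ?A = "{i \<in> {1..n}. Q i}"
  have "card ?A \<le> 1 \<longleftrightarrow> (\<forall>i\<in>?A. \<forall>j\<in>?A. i = j)"
    using card_le_Suc0_iff_eq[of ?A] by simp
  \<comment> \<open>By symmetry, two distinct members may be listed in increasing order, the form in
    which \<open>two_true\<close> takes them.\<close>
  also have "\<dots> \<longleftrightarrow> (\<forall>i\<in>?A. \<forall>j\<in>?A. \<not> i < j)"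
    by (metis nat_neq_iff)
  also have "\<dots> \<longleftrightarrow> \<not> (\<exists>i j. 1 \<le> i \<and> i < j \<and> j \<le> n \<and> Q i \<and> Q j)"
    by simp (meson le_trans less_imp_le)
  finally show ?thesis
    by (subst not_le[symmetric]) blast
qed

text \<open>Gives one direction of the encoding claim and also the models that
  \<open>up_derivesI\<close> asks for.\<close>

lemma cond_amo_cnf_extend_model:
  assumes "n \<ge> 2" "inj_on p {1..n-1}" "p ` {1..n-1} \<inter> insert y (x ` {1..n}) = {}"
    and amo: "\<And>i j. \<alpha> y \<Longrightarrow> 1 \<le> i \<Longrightarrow> i < j \<Longrightarrow> j \<le> n \<Longrightarrow> \<alpha> (x i) \<Longrightarrow> \<alpha> (x j) \<Longrightarrow> False"
  obtains \<beta> where "\<And>v. v \<in> insert y (x ` {1..n}) \<Longrightarrow> \<beta> v = \<alpha> v"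
    "satisfies \<beta> (cond_amo_cnf n x y p)"
proof
  \<comment> \<open>The intended meaning of \<open>p j\<close> is that some input among
    \<open>x 1\<close>, ..., \<open>x j\<close> is true. Injectivity of \<open>p\<close> makes the
    index recoverable from the variable.\<close>
  define \<beta> where "\<beta> v = (if v \<in> p ` {1..n-1}
    then \<exists>i\<in>{1..the_inv_into {1..n-1} p v}. \<alpha> (x i) else \<alpha> v)" for v
  have old: "\<beta> v = \<alpha> v" if "v \<in> insert y (x ` {1..n})" for v
    using that assms(3) unfolding \<beta>_def by auto
  then show "\<And>v. v \<in> insert y (x ` {1..n}) \<Longrightarrow> \<beta> v = \<alpha> v" .
  have y: "\<beta> y = \<alpha> y" and x: "\<And>i. i \<in> {1..n} \<Longrightarrow> \<beta> (x i) = \<alpha> (x i)"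
    by (simp_all add: old)
  have p: "\<beta> (p j) \<longleftrightarrow> (\<exists>i\<in>{1..j}. \<alpha> (x i))" if "j \<in> {1..n-1}" for j
    using that the_inv_into_f_f[OF assms(2) that] unfolding \<beta>_def by auto
  have "\<beta> (p i)" if "i \<in> {1..<n}" "\<beta> (x i)" for i
    using that x[of i] p[of i] by (metis One_nat_def Suc_pred atLeastAtMost_iff atLeastLessThan_iff
      less_Suc_eq_le less_imp_le_nat less_le_trans order_refl zero_less_one)
  then have input: "\<exists>l\<in>{Neg (x i), Pos (p i)}. lit_true \<beta> l" if "i \<in> {1..<n}" for i
    using that by auto
  have "\<beta> (p i)" if i': "i \<in> {1<..<n}" and pi: "\<beta> (p (i - 1))" for i
  proof -
    have i: "i \<in> {1..n-1}" "i - 1 \<in> {1..n-1}"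
      using i' by auto
    then obtain k where "k \<in> {1..i - 1}" "\<alpha> (x k)"
      using pi p by blast
    then show ?thesis
      unfolding p[OF i(1)] by (intro bexI[of _ k]) auto
  qed
  then have counter: "\<exists>l\<in>{Neg (p (i - 1)), Pos (p i)}. lit_true \<beta> l" if "i \<in> {1<..<n}" for i
    using that by auto
  have False if i': "i \<in> {1<..n}" and y': "\<beta> y" and xi: "\<beta> (x i)"
    and pi: "\<beta> (p (i - 1))" for i
  proof -
    \<comment> \<open>A true \<open>p (i - 1)\<close> yields a true input with index below
      \<open>i\<close>, which together with \<open>x i\<close> violates \<open>amo\<close>.\<close>
    have i: "i \<in> {1..n}" "i - 1 \<in> {1..n-1}"
      using i' by auto
    then obtain k where "k \<in> {1..i - 1}" "\<alpha> (x k)"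
      using pi p by blast
    then show False
      by (intro amo[of k i]) (use i' y' xi x[OF i(1)] y in auto)
  qed
  then have bound: "\<exists>l\<in>{Neg y, Neg (x i), Neg (p (i - 1))}. lit_true \<beta> l"
    if "i \<in> {1<..n}" for i
    using that by auto
  show "satisfies \<beta> (cond_amo_cnf n x y p)"
    unfolding satisfies_def cond_amo_cnf_alt[OF assms(1)] ball_Un ball_simps(9)
    by (intro conjI ballI input counter bound)
qed

lemma encodes_cond_amo_cnf:
  assumes "n \<ge> 2" "inj_on p {1..n-1}" "p ` {1..n-1} \<inter> insert y (x ` {1..n}) = {}"
  shows "encodes_cond_at_most (cond_amo_cnf n x y p) n x y 1"
  unfolding encodes_cond_at_most_def
proof (intro allI iffI)
  fix \<alpha> :: "'a \<Rightarrow> bool"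
  have sum: "(\<Sum>i=1..n. of_bool (\<alpha> (x i)) :: nat) = card {i \<in> {1..n}. \<alpha> (x i)}"
    by (simp add: of_bool_def sum.If_cases Int_def)
  have two: "(\<Sum>i=1..n. of_bool (\<alpha> (x i)) :: nat) > 1 \<longleftrightarrow>
      (\<exists>i j. 1 \<le> i \<and> i < j \<and> j \<le> n \<and> \<alpha> (x i) \<and> \<alpha> (x j))"
    unfolding sum by (rule card_gt_1_interval_iff)
  show "\<exists>\<beta>. (\<forall>v\<in>insert y (x ` {1..n}). \<beta> v = \<alpha> v) \<and> satisfies \<beta> (cond_amo_cnf n x y p)"
    if le: "\<alpha> y \<longrightarrow> (\<Sum>i=1..n. of_bool (\<alpha> (x i))) \<le> (1::nat)"
  proof (rule cond_amo_cnf_extend_model[OF assms, of \<alpha>])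
    show False if "\<alpha> y" "1 \<le> i" "i < j" "j \<le> n" "\<alpha> (x i)" "\<alpha> (x j)" for i j
      using le that two by (meson not_le)
  qed blast
  show "\<alpha> y \<longrightarrow> (\<Sum>i=1..n. of_bool (\<alpha> (x i))) \<le> (1::nat)"
    if ex: "\<exists>\<beta>. (\<forall>v\<in>insert y (x ` {1..n}). \<beta> v = \<alpha> v) \<and> satisfies \<beta> (cond_amo_cnf n x y p)"
  proof (rule impI, rule ccontr)
    assume y: "\<alpha> y" and "\<not> (\<Sum>i=1..n. of_bool (\<alpha> (x i))) \<le> (1::nat)"
    then obtain i j where ij: "1 \<le> i" "i < j" "j \<le> n" "\<alpha> (x i)" "\<alpha> (x j)"
      using two by (meson not_le)
    obtain \<beta> where eq: "\<forall>v\<in>insert y (x ` {1..n}). \<beta> v = \<alpha> v"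
      and sat: "satisfies \<beta> (cond_amo_cnf n x y p)"
      using ex by blast
    \<comment> \<open>The literals true in \<open>\<beta>\<close> form a closed set, so
      \<open>two_true\<close> makes \<open>Neg y\<close> true in \<open>\<beta>\<close>, against
      \<open>\<alpha> y\<close>.\<close>
    interpret closed_counter n x p y "{l. lit_true \<beta> l}"
      using assms(1) up_closed_model[OF sat] by unfold_locales
    show False
      using two_true[of i j] ij y eq by auto
  qed
qed

lemma cond_amo_cnf_under_model:
  assumes "n \<ge> 2" "y \<notin> x ` {1..n}" "inj_on p {1..n-1}"
    "p ` {1..n-1} \<inter> insert y (x ` {1..n}) = {}"
    and \<rho>: "partial_assignment (x ` {1..n}) \<rho>" and b: "b \<Longrightarrow> num_true n x \<rho> \<le> 1"
  obtains \<beta> where "satisfies \<beta> (under (cond_amo_cnf n x y p) \<rho>)" "\<beta> y = b"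
proof -
  \<comment> \<open>Unassigned inputs default to false, so the true inputs are exactly those counted
    by \<open>num_true\<close>.\<close>
  define \<alpha> where "\<alpha> v = (if v = y then b else Pos v \<in> \<rho>)" for v
  have x: "\<alpha> (x i) \<longleftrightarrow> Pos (x i) \<in> \<rho>" if "i \<in> {1..n}" for i
    using that assms(2) unfolding \<alpha>_def by auto
  have amo: False if "\<alpha> y" "1 \<le> i" "i < j" "j \<le> n" "\<alpha> (x i)" "\<alpha> (x j)" for i j
  proof -
    have "num_true n x \<rho> > 1"
      unfolding num_true_def card_gt_1_interval_iff using that x[of i] x[of j]
      by (intro exI[of _ i] exI[of _ j]) auto
    then show False
      using b that(1) by (simp add: \<alpha>_def)
  qed
  obtain \<beta> where eq: "\<And>v. v \<in> insert y (x ` {1..n}) \<Longrightarrow> \<beta> v = \<alpha> v"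
    and sat: "satisfies \<beta> (cond_amo_cnf n x y p)"
    using cond_amo_cnf_extend_model[OF assms(1,3,4), of \<alpha>] amo by blast
  have "lit_true \<beta> l" if "l \<in> \<rho>" for l
  proof -
    have "l \<in> Pos ` x ` {1..n} \<union> Neg ` x ` {1..n}" "complement l \<notin> \<rho>"
      using \<rho> that unfolding partial_assignment_def by blast+
    then show ?thesis
      using that eq x by (cases l) auto
  qed
  then show thesis
    using that[of \<beta>] sat eq[of y] by (simp add: satisfies_under \<alpha>_def)
qed

section \<open>Generalized arc consistency by unit propagation\<close>

lemma up_maintains_gac_cond_amo_cnf:
  assumes "n \<ge> 2" "y \<notin> x ` {1..n}" "inj_on p {1..n-1}"
    "p ` {1..n-1} \<inter> insert y (x ` {1..n}) = {}"
  shows "up_maintains_gac (cond_amo_cnf n x y p) n x y 1"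
  unfolding up_maintains_gac_def
proof (intro allI impI conjI ballI)
  let ?F = "cond_amo_cnf n x y p"
  fix \<rho>
  assume \<rho>: "partial_assignment (x ` {1..n}) \<rho>"
  have "finite \<rho>"
    using \<rho> unfolding partial_assignment_def by (auto intro: finite_subset)
  then have fin: "finite (\<Union> (under ?F \<rho>))" "finite (\<Union> (under ?F (\<rho> \<union> {Pos y})))"
    by (simp_all add: finite_cond_amo_cnf)
  \<comment> \<open>Used twice: next to the unit clause for \<open>y\<close> it gives the conflict,
    and without that clause the derivation of \<open>Neg y\<close>.\<close>
  have derives_not_y: "Neg y \<in> P"
    if many: "num_true n x \<rho> > 1" and P: "up_closed ?F P" "\<rho> \<subseteq> P" for P
  proof -
    obtain i j where "1 \<le> i" "i < j" "j \<le> n" "Pos (x i) \<in> \<rho>" "Pos (x j) \<in> \<rho>"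
      using many unfolding num_true_def card_gt_1_interval_iff by blast
    then show ?thesis
      using closed_counter.two_true[OF closed_counter.intro[OF assms(1) P(1)]] P(2) by blast
  qed
  {
    assume many: "num_true n x \<rho> > 1"
    show "up_conflict (under ?F (\<rho> \<union> {Pos y}))"
    proof (rule up_conflictI[OF fin(2)])
      fix P
      assume P: "consistent P" "up_closed (under ?F (\<rho> \<union> {Pos y})) P"
      then have "Neg y \<in> P" "Pos y \<in> P"
        using derives_not_y[OF many] up_closed_under[OF P(2)] by blast+
      then show False
        using P(1) unfolding consistent_def by fastforce
    qed
    \<comment> \<open>With \<open>y\<close> false the bound is vacuous, so a model exists however
      many inputs are true.\<close>
    obtain \<beta> where "satisfies \<beta> (under ?F \<rho>)"
      using cond_amo_cnf_under_model[OF assms \<rho>, of False] by blast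
    then show "up_derives (under ?F \<rho>) (Neg y)"
      using derives_not_y[OF many] up_closed_under by (intro up_derivesI[OF fin(1)]) blast+
  next
    fix j
    assume one: "num_true n x \<rho> = 1" and j: "j \<in> {1..n}"
      and free: "Pos (x j) \<notin> \<rho> \<and> Neg (x j) \<notin> \<rho>"
    obtain i where i: "i \<in> {1..n}" "Pos (x i) \<in> \<rho>"
      using one unfolding num_true_def by (auto simp: card_1_singleton_iff)
    then have "i \<noteq> j"
      using free by blast
    \<comment> \<open>With exactly one true input \<open>y\<close> may be set to true, so the
      formula with the unit clause for \<open>y\<close> stays satisfiable.\<close>
    obtain \<beta> where "satisfies \<beta> (under ?F \<rho>)" "\<beta> y"
      using cond_amo_cnf_under_model[OF assms \<rho>, of True] one by auto
    then have "satisfies \<beta> (under ?F (\<rho> \<union> {Pos y}))"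
      by (simp add: satisfies_under)
    then show "up_derives (under ?F (\<rho> \<union> {Pos y})) (Neg (x j))"
    proof (rule up_derivesI[OF fin(2)])
      fix P
      assume "up_closed (under ?F (\<rho> \<union> {Pos y})) P"
      then have P: "up_closed ?F P" "\<rho> \<union> {Pos y} \<subseteq> P"
        using up_closed_under by blast+
      show "Neg (x j) \<in> P"
        using closed_counter.one_true[OF closed_counter.intro[OF assms(1) P(1)]]
          P(2) i j \<open>i \<noteq> j\<close> by blast
    qed
  }
qed

theorem proposition2:
  fixes n :: nat and x p :: "nat \<Rightarrow> 'v" and y :: 'v
  assumes "n \<ge> 2"
    and "inj_on x {1..n}" and "y \<notin> x ` {1..n}"
    and "inj_on p {1..n-1}" and "p ` {1..n-1} \<inter> insert y (x ` {1..n}) = {}"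
  shows "encodes_cond_at_most (cond_amo_cnf n x y p) n x y 1 \<and>
         up_maintains_gac (cond_amo_cnf n x y p) n x y 1"
  using encodes_cond_amo_cnf[OF assms(1,4,5)] up_maintains_gac_cond_amo_cnf[OF assms(1,3,4,5)]
  by (rule conjI)

end
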